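(* Let $0<\alpha<1$, $0\le\theta\le1$, let $\Omega=(a,b)$, and let $\kappa$ satisfy $c_0\le\kappa(x)\le c_1$ on $\Omega$ for some positive constants $c_0,c_1$. Then the finite difference solution $U^n$ of the two-sided scheme $$\kappa^{n-1/2}\Big[\theta\,\big({}_aI_x^{1-\alpha}\delta U\big)(x_n)+(1-\theta)\,\big({}_xI_b^{1-\alpha}\delta U\big)(x_{n-1})\Big]-\kappa^{n+1/2}\Big[\theta\,\big({}_aI_x^{1-\alpha}\delta U\big)(x_{n+1})+(1-\theta)\,\big({}_xI_b^{1-\alpha}\delta U\big)(x_{n})\Big]=h^2f^n,$$ for $n=1,\dots,P-1$, with $U^0=U^P=0$, exists and is unique.
   Context: Uniform mesh: $P\ge 2$ is an integer, $h=(b-a)/P$, $x_n=a+nh$ for $0\le n\le P$, $I_n=(x_{n-1},x_n)$, $x_{n+1/2}=(x_n+x_{n+1})/2$, $\kappa^{n+1/2}=\kappa(x_{n+1/2})$, $f^n=f(x_n)$ where $f$ is a given source function on $\Omega$. For nodal values $U^0,\dots,U^P$, the backward difference $\delta U$ is the piecewise constant function $\delta U(x)=\delta U^n:=U^n-U^{n-1}$ for $x\in I_n$. The left- and right-sided Riemann–Liouville fractional integrals are ${}_aI_x^{1-\alpha}v(x)=\int_a^x\omega_{1-\alpha}(x-z)v(z)\,dz$ and ${}_xI_b^{1-\alpha}v(x)=\int_x^b\omega_{1-\alpha}(z-x)v(z)\,dz$, with $\omega_{1-\alpha}(x)=x^{-\alpha}/\Gamma(1-\alpha)$. Hence $$\big({}_aI_x^{1-\alpha}\delta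 U\big)(x_n)=\omega_{2-\alpha}(h)\sum_{j=1}^n w_{n,j}\,\delta U^j,\qquad \big({}_xI_b^{1-\alpha}\delta U\big)(x_{n-1})=\omega_{2-\alpha}(h)\sum_{j=n}^P w_{j,n}\,\delta U^j,$$ where $\omega_{2-\alpha}(h)=h^{1-\alpha}/\Gamma(2-\alpha)$ and $w_{n,j}=(n+1-j)^{1-\alpha}-(n-j)^{1-\alpha}$ for $n\ge j\ge1$. The scheme approximates $-\partial_x(\kappa\,\partial_x^{\alpha,\theta}u)=f$ on $\Omega$ with $u(a)=u(b)=0$, where $\partial_x^{\alpha,\theta}v=\theta\,\partial_x\,{}_aI_x^{1-\alpha}v+(1-\theta)\,\partial_x\,{}_xI_b^{1-\alpha}v$. *)

theory Defs
  imports "HOL-Analysis.Analysis"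
begin

definition omega :: "real \<Rightarrow> real \<Rightarrow> real" where
  "omega \<beta> x = x powr (\<beta> - 1) / Gamma \<beta>"

text \<open>The fractional integrals have order \<open>\<mu>\<close>, which the scheme instantiates to \<open>1 - \<alpha>\<close>.
  At the singular endpoint \<open>z = x\<close> the integrand is \<open>0\<close> because \<open>0 powr _ = 0\<close>;
  this does not affect the integral.\<close>

definition RL_left :: "real \<Rightarrow> real \<Rightarrow> (real \<Rightarrow> real) \<Rightarrow> real \<Rightarrow> real" where
  "RL_left \<mu> a v x = integral {a..x} (\<lambda>z. omega \<mu> (x - z) * v z)"

definition RL_right :: "real \<Rightarrow> real \<Rightarrow> (real \<Rightarrow> real) \<Rightarrow> real \<Rightarrow> real" where
  "RL_right \<mu> b v x = integral {x..b} (\<lambda>z. omega \<mu> (z - x) * v z)"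

definition mesh_size :: "real \<Rightarrow> real \<Rightarrow> nat \<Rightarrow> real" where
  "mesh_size a b P = (b - a) / real P"

definition node :: "real \<Rightarrow> real \<Rightarrow> nat \<Rightarrow> nat \<Rightarrow> real" where
  "node a b P n = a + real n * mesh_size a b P"

text \<open>\<open>midnode a b P n\<close> is $x_{n+1/2}$.\<close>

definition midnode :: "real \<Rightarrow> real \<Rightarrow> nat \<Rightarrow> nat \<Rightarrow> real" where
  "midnode a b P n = (node a b P n + node a b P (n + 1)) / 2"

text \<open>The piecewise constant function equal to $U^n - U^{n-1}$ on the open cell
  $(x_{n-1}, x_n)$, with value \<open>0\<close> at the nodes, where the mathematics leaves it unspecified.\<close>

definition backward_diff :: "real \<Rightarrow> real \<Rightarrow> nat \<Rightarrow> (nat \<Rightarrow> real) \<Rightarrow> real \<Rightarrow> real" where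
  "backward_diff a b P U x =
     (\<Sum>n = 1..P. (U n - U (n - 1)) * indicator {node a b P (n - 1) <..< node a b P n} x)"

text \<open>The bracket $\theta\,({}_aI_x^{1-\alpha}\delta U)(x_n)
  + (1-\theta)\,({}_xI_b^{1-\alpha}\delta U)(x_{n-1})$, for $n \geq 1$.\<close>

definition frac_bracket ::
  "real \<Rightarrow> real \<Rightarrow> nat \<Rightarrow> real \<Rightarrow> real \<Rightarrow> (nat \<Rightarrow> real) \<Rightarrow> nat \<Rightarrow> real" where
  "frac_bracket a b P \<alpha> \<theta> U n =
     \<theta> * RL_left (1 - \<alpha>) a (backward_diff a b P U) (node a b P n)
     + (1 - \<theta>) * RL_right (1 - \<alpha>) b (backward_diff a b P U) (node a b P (n - 1))"

definition fd_solution ::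
  "real \<Rightarrow> real \<Rightarrow> nat \<Rightarrow> real \<Rightarrow> real \<Rightarrow> (real \<Rightarrow> real) \<Rightarrow> (real \<Rightarrow> real)
     \<Rightarrow> (nat \<Rightarrow> real) \<Rightarrow> bool" where
  "fd_solution a b P \<alpha> \<theta> \<kappa> f U \<longleftrightarrow>
     U 0 = 0 \<and> U P = 0 \<and>
     (\<forall>n \<in> {1..P - 1}.
        \<kappa> (midnode a b P (n - 1)) * frac_bracket a b P \<alpha> \<theta> U n
        - \<kappa> (midnode a b P n) * frac_bracket a b P \<alpha> \<theta> U (n + 1)
        = (mesh_size a b P)\<^sup>2 * f (node a b P n))"

end

theory Submission
  imports Defs "Jordan_Normal_Form.Determinant"
begin

text \<open>Because \<open>\<delta>U\<close> is constant on each cell, the fractional integrals can be evaluated exactly, and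
  the bracket at index \<open>n\<close> is a positive multiple of \<open>(M d) n\<close>, where \<open>d j = U j - U (j - 1)\<close>
  and \<open>M\<close> is the Toeplitz matrix with entries \<open>\<theta> w(n - j) + (1 - \<theta>) w(j - n)\<close>,
  where \<open>w\<close> denotes the weights extended by zero to negative arguments
  (\<open>frac_bracket_eq_toeplitz\<close>). Summed over the nodes, the scheme says
  \<open>(M d) n = g n * (C - F n)\<close> for all cells \<open>n\<close>, with an unknown constant \<open>C\<close>, a positive
  vector \<open>g\<close> proportional to \<open>1 / \<kappa>\<close> and known partial sums \<open>F\<close> of the source. The boundary
  conditions amount to \<open>\<Sum>j. d j = 0\<close>.

  If \<open>M\<close> is invertible, then \<open>d\<close> is determined by \<open>C\<close>, and it remains to see that
  \<open>\<Sum>j. d j = 0\<close> fixes \<open>C\<close>. Since \<open>\<kappa>\<close> varies, coercivity of \<open>M\<close> does not settle this. Instead, let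
  \<open>z\<close> solve the transposed system with right-hand side \<open>1\<close>; then \<open>\<Sum>j. d j = \<Sum>n. z n * (M d) n\<close> is
  an affine function of \<open>C\<close> with slope \<open>\<Sum>n. z n * g n\<close>, which is nonzero for every positive
  \<open>g\<close> as soon as \<open>z\<close> has one sign (\<open>equilibrium_functional\<close>).

  Both invertibility and the sign of \<open>z\<close> come from one fact: if \<open>M y\<close> is constant, then all entries of
  \<open>y\<close> have the same sign (\<open>toeplitz_constant_imp_nonneg\<close>). It is a discrete maximum
  principle: the weights are decreasing and convex, so second differences of the kernel
  form a strictly diagonally dominant matrix with nonpositive off-diagonal entries. The transpose of
  \<open>M\<close> is the same matrix for \<open>1 - \<theta>\<close>, so the fact applies to it as well.\<close>

section \<open>Linear algebra and summation\<close>

lemma square_system_solvable: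
  fixes A :: "nat \<Rightarrow> nat \<Rightarrow> real"
  assumes inj: "\<And>v. (\<And>i. i \<in> {1..n} \<Longrightarrow> (\<Sum>j=1..n. A i j * v j) = 0) \<Longrightarrow> (\<And>j. j \<in> {1..n} \<Longrightarrow> v j = 0)"
  obtains v where "\<And>i. i \<in> {1..n} \<Longrightarrow> (\<Sum>j=1..n. A i j * v j) = r i"
proof -
  define M where "M = mat n n (\<lambda>(i, j). A (Suc i) (Suc j))"
  have M: "M \<in> carrier_mat n n" by (simp add: M_def)
  have mult: "vec_index (M *\<^sub>v x) i = (\<Sum>j=1..n. A (Suc i) j * vec_index x (j - 1))"
    if "x \<in> carrier_vec n" "i < n" for x i
    using that by (simp add: M_def scalar_prod_def sum.atLeast1_atMost_eq lessThan_atLeast0)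
  have "det M \<noteq> 0"
  proof
    assume "det M = 0"
    then obtain x where x: "x \<in> carrier_vec n" "x \<noteq> 0\<^sub>v n" "M *\<^sub>v x = 0\<^sub>v n"
      using det_0_iff_vec_prod_zero[OF M] by blast
    have "(\<Sum>j=1..n. A i j * vec_index x (j - 1)) = 0" if "i \<in> {1..n}" for i
      using mult[OF x(1), of "i - 1"] x(3) that by auto
    then have z: "vec_index x (j - 1) = 0" if "j \<in> {1..n}" for j
      using inj[of "\<lambda>j. vec_index x (j - 1)" j] that by blast
    have "vec_index x j = 0" if "j < n" for j
      using z[of "Suc j"] that by simp
    then have "x = 0\<^sub>v n" using x(1) by (intro eq_vecI) auto
    with x(2) show False ..
  qed
  then have "M \<in> Units (ring_mat TYPE(real) n ())" by (rule det_non_zero_imp_unit[OF M])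
  then obtain B where B: "B \<in> carrier_mat n n" "M * B = 1\<^sub>m n"
    by (auto simp: Units_def ring_mat_def)
  define x where "x = B *\<^sub>v vec n (\<lambda>i. r (Suc i))"
  have x: "x \<in> carrier_vec n" using B by (simp add: x_def)
  have Mx: "M *\<^sub>v x = vec n (\<lambda>i. r (Suc i))"
    unfolding x_def using B M by (subst assoc_mult_mat_vec[symmetric, of _ n n _ n]) auto
  show ?thesis
  proof (rule that[of "\<lambda>j. vec_index x (j - 1)"])
    fix i assume "i \<in> {1..n}"
    then show "(\<Sum>j=1..n. A i j * vec_index x (j - 1)) = r i"
      using mult[OF x, of "i - 1"] Mx by auto
  qed
qed

lemma summation_by_parts:
  fixes e U :: "nat \<Rightarrow> real"
  assumes "P \<ge> 1"
  shows "(\<Sum>j=1..P. e j * (U j - U (j - 1))) =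
           e P * U P - e 1 * U 0 + (\<Sum>j=1..P-1. (e j - e (j + 1)) * U j)"
  using assms
proof (induction P rule: dec_induct)
  case (step n)
  then obtain k where "n = Suc k" by (cases n) auto
  with step show ?case by (simp add: algebra_simps)
qed (simp add: algebra_simps)

text \<open>At an index where \<open>v\<close> is minimal, replacing every \<open>v j\<close> by that minimum can only increase
  the row, because the off-diagonal entries are nonpositive; the row becomes the row sum times the
  minimum, so the minimum cannot be negative.\<close>

lemma Z_matrix_minimum_principle:
  fixes A :: "'i \<Rightarrow> 'i \<Rightarrow> real"
  assumes "finite I"
    and off: "\<And>i j. i \<in> I \<Longrightarrow> j \<in> I \<Longrightarrow> i \<noteq> j \<Longrightarrow> A i j \<le> 0"
    and row: "\<And>i. i \<in> I \<Longrightarrow> (\<Sum>j\<in>I. A i j) > 0"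
    and super: "\<And>i. i \<in> I \<Longrightarrow> (\<Sum>j\<in>I. A i j * v j) \<ge> 0"
    and "k \<in> I"
  shows "v k \<ge> 0"
proof -
  define i where "i = arg_min_on v I"
  have i: "i \<in> I" "\<And>j. j \<in> I \<Longrightarrow> v i \<le> v j"
    using assms(1,5) arg_min_if_finite[of I v] arg_min_least[of I _ v] by (auto simp: i_def)
  have "0 \<le> (\<Sum>j\<in>I. A i j * v j)" using super i by blast
  also have "\<dots> \<le> (\<Sum>j\<in>I. A i j * v i)"
  proof (rule sum_mono)
    fix j assume "j \<in> I"
    then show "A i j * v j \<le> A i j * v i"
      using off[of i j] i by (cases "i = j") (auto intro: mult_left_mono_neg)
  qed
  also have "\<dots> = (\<Sum>j\<in>I. A i j) * v i" by (simp add: sum_distrib_right)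
  finally have "v i \<ge> 0" using row[OF i(1)] by (simp add: zero_le_mult_iff)
  with i(2) \<open>k \<in> I\<close> show ?thesis by force
qed

section \<open>The Toeplitz kernel of the fractional flux\<close>

text \<open>The arithmetic-geometric mean inequality applied to \<open>x powr r\<close> and \<open>(x + 2) powr r\<close>, whose
  geometric mean is controlled by \<open>x * (x + 2) \<le> (x + 1)\<^sup>2\<close>.\<close>

lemma powr_midpoint_convex:
  fixes x r :: real
  assumes "x > 0" "r \<le> 0"
  shows "2 * (x + 1) powr r \<le> x powr r + (x + 2) powr r"
proof -
  have "(x + 1) powr r = ((x + 1) * (x + 1)) powr (r / 2)"
    using assms by (simp add: powr_mult powr_add[symmetric])
  also have "\<dots> \<le> (x * (x + 2)) powr (r / 2)"
    using assms by (intro powr_mono2') (auto simp: algebra_simps add_pos_pos)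
  also have "\<dots> = x powr (r / 2) * (x + 2) powr (r / 2)"
    using assms by (simp add: powr_mult)
  finally have "2 * (x + 1) powr r \<le> 2 * (x powr (r / 2) * (x + 2) powr (r / 2))" by simp
  also have "\<dots> \<le> (x powr (r / 2))\<^sup>2 + ((x + 2) powr (r / 2))\<^sup>2"
    using sum_squares_bound[of "x powr (r / 2)" "(x + 2) powr (r / 2)"] by simp
  also have "\<dots> = x powr r + (x + 2) powr r"
    using assms by (simp add: power2_eq_square powr_add[symmetric])
  finally show ?thesis .
qed

text \<open>Minus the second difference of the power function. Its sign and its monotonicity, which express
  concavity of \<open>x powr s\<close> and convexity of \<open>x powr (s - 1)\<close>, are the only analytic input
  to the sign pattern of the kernel.\<close>

definition powr_gap :: "real \<Rightarrow> real \<Rightarrow> real" where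
  "powr_gap s x = 2 * (x + 1) powr s - x powr s - (x + 2) powr s"

lemma powr_gap_pos:
  assumes "0 < s" "s < 1" "0 \<le> x"
  shows "powr_gap s x > 0"
proof -
  define D where "D t = (t + 1) powr s - t powr s" for t :: real
  have "D (x + 1) < D x"
  proof (rule DERIV_neg_imp_decreasing_open[of x "x + 1" D])
    show "continuous_on {x..x+1} D"
      unfolding D_def using assms by (intro continuous_intros continuous_on_powr') auto
    fix t assume "x < t" "t < x + 1"
    then have "(D has_real_derivative s * ((t + 1) powr (s - 1) - t powr (s - 1))) (at t)"
      unfolding D_def using assms
      by (auto intro!: derivative_eq_intros simp: algebra_simps)
    moreover have "(t + 1) powr (s - 1) < t powr (s - 1)"
      using assms \<open>x < t\<close> by (intro powr_less_mono2_neg) auto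
    ultimately show "\<exists>y. (D has_real_derivative y) (at t) \<and> y < 0"
      using assms by (intro exI conjI) (auto simp: mult_pos_neg)
  qed simp
  then show ?thesis by (simp add: D_def powr_gap_def algebra_simps)
qed

lemma powr_gap_antimono:
  assumes "0 < s" "s < 1" "0 \<le> x" "x \<le> y"
  shows "powr_gap s y \<le> powr_gap s x"
proof (rule DERIV_nonpos_imp_decreasing_open[OF \<open>x \<le> y\<close>])
  show "continuous_on {x..y} (powr_gap s)"
    unfolding powr_gap_def using assms by (intro continuous_intros continuous_on_powr') auto
  fix t assume "x < t" "t < y"
  then have "(powr_gap s has_real_derivative
      s * (2 * (t + 1) powr (s - 1) - t powr (s - 1) - (t + 2) powr (s - 1))) (at t)"
    unfolding powr_gap_def using assms
    by (auto intro!: derivative_eq_intros simp: algebra_simps)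
  moreover have "2 * (t + 1) powr (s - 1) \<le> t powr (s - 1) + (t + 2) powr (s - 1)"
    using assms \<open>x < t\<close> by (intro powr_midpoint_convex) auto
  ultimately show "\<exists>z. (powr_gap s has_real_derivative z) (at t) \<and> z \<le> 0"
    using assms by (intro exI conjI) (auto simp: mult_nonneg_nonpos)
qed

text \<open>With \<open>s = 1 - \<alpha>\<close> the value at \<open>k = n - j\<close> is the weight $w_{n,j}$. Extending by zero to
  negative \<open>k\<close> lets the sums over \<open>j \<le> n\<close> and \<open>j \<ge> n\<close> both run over all cells.\<close>

definition weight :: "real \<Rightarrow> int \<Rightarrow> real" where
  "weight s k = (if k < 0 then 0 else (of_int k + 1) powr s - of_int k powr s)"

lemma weight_nonneg: "0 < s \<Longrightarrow> weight s k \<ge> 0"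
  by (simp add: weight_def powr_mono2)

lemma weight_drop: "0 \<le> k \<Longrightarrow> weight s k - weight s (k + 1) = powr_gap s (of_int k)"
  by (simp add: weight_def powr_gap_def algebra_simps)

lemma weight_drop_neg: "k < 0 \<Longrightarrow> weight s k - weight s (k + 1) \<le> 0"
  by (cases "k = - 1") (auto simp: weight_def)

lemma weight_drop_pos:
  assumes "0 < s" "s < 1" "0 \<le> k"
  shows "weight s k - weight s (k + 1) > 0"
  using assms by (simp add: weight_drop powr_gap_pos)

text \<open>For \<open>k > 0\<close> this is convexity of the weights; for \<open>k < 0\<close> only the jump of the zero
  extension at \<open>0\<close> contributes, and it has the right sign. At \<open>k = 0\<close> that jump gives the
  opposite sign.\<close>

lemma weight_second_diff:
  assumes "0 < s" "s < 1" "k \<noteq> 0"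
  shows "2 * weight s k - weight s (k + 1) - weight s (k - 1) \<le> 0"
proof (cases "k < 0")
  case True
  then show ?thesis by (cases "k = - 1") (auto simp: weight_def)
next
  case False
  then have "powr_gap s (of_int k) \<le> powr_gap s (of_int (k - 1))"
    using assms by (intro powr_gap_antimono) auto
  then show ?thesis
    using False assms weight_drop[of k s] weight_drop[of "k - 1" s] by simp
qed

definition flux_kernel :: "real \<Rightarrow> real \<Rightarrow> int \<Rightarrow> real" where
  "flux_kernel s \<theta> k = \<theta> * weight s k + (1 - \<theta>) * weight s (- k)"

text \<open>Reflecting the kernel exchanges the two sides, so transposed systems need no separate
  treatment.\<close>

lemma flux_kernel_minus: "flux_kernel s \<theta> (- k) = flux_kernel s (1 - \<theta>) k"
  by (simp add: flux_kernel_def)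

lemma flux_kernel_nonneg: "0 < s \<Longrightarrow> 0 \<le> \<theta> \<Longrightarrow> \<theta> \<le> 1 \<Longrightarrow> flux_kernel s \<theta> k \<ge> 0"
  by (simp add: flux_kernel_def weight_nonneg)

lemma flux_kernel_0: "flux_kernel s \<theta> 0 = 1"
  by (simp add: flux_kernel_def weight_def)

definition flux_kernel_drop :: "real \<Rightarrow> real \<Rightarrow> int \<Rightarrow> real" where
  "flux_kernel_drop s \<theta> k = flux_kernel s \<theta> k - flux_kernel s \<theta> (k + 1)"

lemma flux_kernel_drop_eq:
  "flux_kernel_drop s \<theta> k = \<theta> * (weight s k - weight s (k + 1))
     - (1 - \<theta>) * (weight s (- k - 1) - weight s (- k - 1 + 1))"
proof -
  have "- k - 1 + 1 = - k" "- (k + 1) = - k - 1" by simp_all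
  then show ?thesis
    unfolding flux_kernel_drop_def flux_kernel_def by (simp only: left_diff_distrib right_diff_distrib)
qed

lemma flux_kernel_drop_nonneg:
  assumes "0 < s" "s < 1" "0 \<le> \<theta>" "\<theta> \<le> 1" "0 \<le> k"
  shows "flux_kernel_drop s \<theta> k \<ge> 0"
  using assms mult_nonneg_nonneg[of \<theta> "weight s k - weight s (k + 1)"]
    mult_nonneg_nonpos[of "1 - \<theta>" "weight s (- k - 1) - weight s (- k - 1 + 1)"]
    weight_drop_pos[of s k] weight_drop_neg[of "- k - 1" s]
  unfolding flux_kernel_drop_eq by linarith

lemma flux_kernel_drop_nonpos:
  assumes "0 < s" "s < 1" "0 \<le> \<theta>" "\<theta> \<le> 1" "k < 0"
  shows "flux_kernel_drop s \<theta> k \<le> 0"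
  using assms mult_nonneg_nonpos[of \<theta> "weight s k - weight s (k + 1)"]
    mult_nonneg_nonneg[of "1 - \<theta>" "weight s (- k - 1) - weight s (- k - 1 + 1)"]
    weight_drop_pos[of s "- k - 1"] weight_drop_neg[of k s]
  unfolding flux_kernel_drop_eq by linarith

text \<open>Strictness holds for all \<open>\<theta>\<close>, including the one-sided cases: the left-sided part
  contributes strictly when \<open>\<theta> > 0\<close>, the right-sided part when \<open>\<theta> < 1\<close>. This is the
  strict diagonal dominance used below.\<close>

lemma flux_kernel_drop_less:
  assumes "0 < s" "s < 1" "0 \<le> \<theta>" "\<theta> \<le> 1" "l < 0" "0 \<le> k"
  shows "flux_kernel_drop s \<theta> l < flux_kernel_drop s \<theta> k"
proof (cases "\<theta> = 0")
  case True
  then show ?thesis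
    using assms weight_drop_pos[of s "- l - 1"] weight_drop_neg[of "- k - 1" s]
    unfolding flux_kernel_drop_eq by simp
next
  case False
  then have "\<theta> * (weight s k - weight s (k + 1)) > 0"
    using assms weight_drop_pos[of s k] by simp
  moreover have "\<theta> * (weight s l - weight s (l + 1)) \<le> 0"
    using assms weight_drop_neg[of l s] by (simp add: mult_nonneg_nonpos)
  moreover have "(1 - \<theta>) * (weight s (- l - 1) - weight s (- l - 1 + 1)) \<ge> 0"
    using assms weight_drop_pos[of s "- l - 1"] by (intro mult_nonneg_nonneg) auto
  moreover have "(1 - \<theta>) * (weight s (- k - 1) - weight s (- k - 1 + 1)) \<le> 0"
    using assms weight_drop_neg[of "- k - 1" s] by (intro mult_nonneg_nonpos) auto
  ultimately show ?thesis unfolding flux_kernel_drop_eq by linarith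
qed

lemma flux_kernel_second_diff_nonpos:
  assumes "0 < s" "s < 1" "0 \<le> \<theta>" "\<theta> \<le> 1" "k \<noteq> 0"
  shows "flux_kernel_drop s \<theta> k - flux_kernel_drop s \<theta> (k - 1) \<le> 0"
proof -
  have "flux_kernel_drop s \<theta> k - flux_kernel_drop s \<theta> (k - 1) =
      \<theta> * (2 * weight s k - weight s (k + 1) - weight s (k - 1))
      + (1 - \<theta>) * (2 * weight s (- k) - weight s (- k + 1) - weight s (- k - 1))"
  proof -
    have "- (k - 1) = - k + 1" "- (k + 1) = - k - 1" "k - 1 + 1 = k" by simp_all
    moreover have "\<theta> * u + (1 - \<theta>) * u' - (\<theta> * v + (1 - \<theta>) * v')
        - (\<theta> * w + (1 - \<theta>) * w' - (\<theta> * u + (1 - \<theta>) * u'))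
        = \<theta> * (2 * u - v - w) + (1 - \<theta>) * (2 * u' - w' - v')" for u u' v v' w w' :: real
      by (simp add: algebra_simps)
    ultimately show ?thesis
      unfolding flux_kernel_drop_def flux_kernel_def by (simp only:)
  qed
  also have "\<dots> \<le> 0"
    using assms weight_second_diff[of s k] weight_second_diff[of s "- k"]
    by (intro add_nonpos_nonpos mult_nonneg_nonpos) auto
  finally show ?thesis .
qed


section \<open>Sign and solvability of the Toeplitz system\<close>

definition toeplitz :: "real \<Rightarrow> real \<Rightarrow> nat \<Rightarrow> (nat \<Rightarrow> real) \<Rightarrow> nat \<Rightarrow> real" where
  "toeplitz s \<theta> P y n = (\<Sum>j=1..P. flux_kernel s \<theta> (int n - int j) * y j)"

lemma toeplitz_diff:
  "toeplitz s \<theta> P y n - toeplitz s \<theta> P y (n + 1) =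
     (\<Sum>j=1..P. flux_kernel_drop s \<theta> (int n - int j) * y j)"
  by (simp add: toeplitz_def flux_kernel_drop_def sum_subtractf left_diff_distrib
      add_diff_eq diff_add_eq algebra_simps)

lemma flux_kernel_drop_telescope:
  assumes "l \<le> r"
  shows "(\<Sum>j=l..<r. flux_kernel_drop s \<theta> (int n - int j) - flux_kernel_drop s \<theta> (int n - int j - 1))
    = flux_kernel_drop s \<theta> (int n - int l) - flux_kernel_drop s \<theta> (int n - int r)"
  using assms by (induction r rule: dec_induct) (simp_all add: algebra_simps)

text \<open>Differences of consecutive equations annihilate the constant. Written in the partial sums
  \<open>U\<close>, they form a system whose matrix \<open>A\<close> (second differences of the kernel) satisfies the
  minimum principle; boundary values \<open>0\<close> and \<open>S \<ge> 0\<close> then force \<open>0 \<le> U \<le> S\<close>, which gives the sign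
  of the first and the last entry of \<open>y\<close>. Taking differences once more gives the same matrix \<open>A\<close>,
  by translation invariance, now acting on \<open>y\<close> itself, and a second use of the principle
  settles the inner entries.\<close>

lemma toeplitz_constant_imp_nonneg:
  assumes s: "0 < s" "s < 1" and \<theta>: "0 \<le> \<theta>" "\<theta> \<le> 1" and P: "P \<ge> 1"
    and const: "\<And>n. n \<in> {1..P} \<Longrightarrow> toeplitz s \<theta> P y n = c"
    and total: "(\<Sum>j=1..P. y j) \<ge> 0"
    and k: "k \<in> {1..P}"
  shows "y k \<ge> 0"
proof -
  define g where "g = flux_kernel_drop s \<theta>"
  define A where "A i j = g (int i - int j) - g (int i - int j - 1)" for i j :: nat
  define S where "S = (\<Sum>j=1..P. y j)"
  define U where "U n = (\<Sum>j=1..n. y j)" for n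
  have U: "U 0 = 0" "U P = S" "\<And>n. n \<ge> 1 \<Longrightarrow> U n - U (n - 1) = y n"
  proof -
    show "U n - U (n - 1) = y n" if "n \<ge> 1" for n
      using that by (cases n) (simp_all add: U_def)
  qed (simp_all add: U_def S_def)
  have g_less: "g l < g r" if "l < 0" "0 \<le> r" for l r
    unfolding g_def using flux_kernel_drop_less[OF s \<theta>] that by blast
  have g_nonneg: "g l \<ge> 0" if "0 \<le> l" for l
    unfolding g_def using flux_kernel_drop_nonneg[OF s \<theta>] that by blast
  have g_nonpos: "g l \<le> 0" if "l < 0" for l
    unfolding g_def using flux_kernel_drop_nonpos[OF s \<theta>] that by blast
  have off: "A i j \<le> 0" if "i \<noteq> j" for i j
    unfolding A_def g_def using flux_kernel_second_diff_nonpos[OF s \<theta>] that by simp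
  have tel: "(\<Sum>j=l..<r. A i j) = g (int i - int l) - g (int i - int r)" if "l \<le> r" for i l r
    unfolding A_def g_def using flux_kernel_drop_telescope[OF that] .
  have row: "(\<Sum>j=l..<r. A i j) > 0" if "i \<in> {l..<r}" for i l r
    using that tel[of l r i] g_less[of "int i - int r" "int i - int l"] by simp
  have gy: "(\<Sum>j=1..P. g (int n - int j) * y j) = 0" if "n \<in> {1..<P}" for n
    using that const[of n] const[of "n + 1"] unfolding g_def toeplitz_diff[symmetric] by simp
  have AU: "(\<Sum>j=1..<P. A n j * U j) = - g (int n - int P) * S" if "n \<in> {1..<P}" for n
  proof -
    have "0 = (\<Sum>j=1..P. g (int n - int j) * (U j - U (j - 1)))"
      unfolding gy[OF that, symmetric]
      by (intro sum.cong) (simp_all only: U(3) atLeastAtMost_iff)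
    also have "\<dots> = g (int n - int P) * S + (\<Sum>j=1..P-1. A n j * U j)"
      using summation_by_parts[OF P, of "\<lambda>j. g (int n - int j)" U] P
      by (simp add: U A_def algebra_simps)
    also have "{1..P-1} = {1..<P}" using P by auto
    finally show ?thesis by simp
  qed
  \<comment> \<open>\<open>U\<close> and \<open>S - U\<close> are both supersolutions, as the boundary terms \<open>- g (i - P) * S\<close> and
    \<open>g (i - 1) * S\<close> are nonnegative.\<close>
  have U_lower: "U j \<ge> 0" if "j \<in> {1..<P}" for j
  proof (rule Z_matrix_minimum_principle[of "{1..<P}" A U j])
    fix i assume i: "i \<in> {1..<P}"
    then show "(\<Sum>j\<in>{1..<P}. A i j * U j) \<ge> 0"
      using g_nonpos[of "int i - int P"] total AU[OF i]
      by (simp add: S_def mult_nonpos_nonneg)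
  qed (use off row that in auto)
  have U_upper: "S - U j \<ge> 0" if "j \<in> {1..<P}" for j
  proof (rule Z_matrix_minimum_principle[of "{1..<P}" A "\<lambda>j. S - U j" j])
    fix i assume i: "i \<in> {1..<P}"
    have "(\<Sum>j\<in>{1..<P}. A i j * (S - U j)) = (\<Sum>j=1..<P. A i j) * S - (\<Sum>j=1..<P. A i j * U j)"
      by (simp add: right_diff_distrib sum_subtractf sum_distrib_right)
    also have "\<dots> = g (int i - 1) * S"
      unfolding AU[OF i] tel[OF P] by (simp add: algebra_simps)
    also have "\<dots> \<ge> 0"
      using g_nonneg[of "int i - 1"] total i by (simp add: S_def)
    finally show "(\<Sum>j\<in>{1..<P}. A i j * (S - U j)) \<ge> 0" .
  qed (use off row that in auto)
  have y1: "y 1 \<ge> 0"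
    using U(3)[of 1] U_lower[of 1] U(1,2) total P by (cases "P = 1") (auto simp: S_def)
  have yP: "y P \<ge> 0"
    using U(3)[of P] U_upper[of "P - 1"] U(2) y1 P by (cases "P = 1") auto
  have y_inner: "y j \<ge> 0" if "j \<in> {2..<P}" for j
  proof (rule Z_matrix_minimum_principle[of "{2..<P}" A y j])
    fix i assume i: "i \<in> {2..<P}"
    have shift: "int (i - 1) - int j = int i - int j - 1" for j
      using i by simp
    have inner: "i \<in> {1..<P}" "i - 1 \<in> {1..<P}" using i by auto
    have "0 = (\<Sum>j=1..P. g (int i - int j) * y j) - (\<Sum>j=1..P. g (int (i - 1) - int j) * y j)"
      unfolding gy[OF inner(1)] gy[OF inner(2)] by simp
    also have "\<dots> = (\<Sum>j=1..P. A i j * y j)"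
      by (simp only: shift A_def sum_subtractf left_diff_distrib)
    \<comment> \<open>The first and last columns carry nonpositive coefficients and entries already known to be
      nonnegative, so discarding them leaves a nonnegative sum.\<close>
    also have "{1..P} = insert 1 (insert P {2..<P})" using i by auto
    also have "(\<Sum>j\<in>\<dots>. A i j * y j) = A i 1 * y 1 + A i P * y P + (\<Sum>j=2..<P. A i j * y j)"
      using i by simp
    finally show "(\<Sum>j=2..<P. A i j * y j) \<ge> 0"
      using off[of i 1] off[of i P] y1 yP i mult_nonpos_nonneg[of "A i 1" "y 1"]
        mult_nonpos_nonneg[of "A i P" "y P"] by auto
  qed (use off row that in auto)
  from k consider "k = 1" | "k = P" | "k \<in> {2..<P}" by force
  then show ?thesis using y1 yP y_inner by cases auto
qed

lemma toeplitz_uminus: "toeplitz s \<theta> P (\<lambda>j. - y j) n = - toeplitz s \<theta> P y n"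
  by (simp add: toeplitz_def sum_negf)

lemma toeplitz_constant_imp_one_signed:
  assumes "0 < s" "s < 1" "0 \<le> \<theta>" "\<theta> \<le> 1" "P \<ge> 1"
    and "\<And>n. n \<in> {1..P} \<Longrightarrow> toeplitz s \<theta> P y n = c"
  obtains \<sigma> :: real where "\<sigma> \<noteq> 0" "\<And>j. j \<in> {1..P} \<Longrightarrow> \<sigma> * y j \<ge> 0"
proof (cases "(\<Sum>j=1..P. y j) \<ge> 0")
  case True
  then show ?thesis using toeplitz_constant_imp_nonneg[OF assms] by (intro that[of 1]) auto
next
  case False
  have "- y j \<ge> 0" if "j \<in> {1..P}" for j
    by (rule toeplitz_constant_imp_nonneg[OF assms(1-5), where c = "- c" and y = "\<lambda>j. - y j"])
      (use assms(6) False that in \<open>auto simp: toeplitz_uminus sum_negf\<close>)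
  then show ?thesis by (intro that[of "- 1"]) auto
qed

text \<open>A one-signed solution of the homogeneous system vanishes, since the kernel is nonnegative
  with unit diagonal.\<close>

lemma toeplitz_injective:
  assumes s: "0 < s" "s < 1" and \<theta>: "0 \<le> \<theta>" "\<theta> \<le> 1"
    and zero: "\<And>n. n \<in> {1..P} \<Longrightarrow> toeplitz s \<theta> P y n = 0"
    and k: "k \<in> {1..P}"
  shows "y k = 0"
proof -
  from k have "P \<ge> 1" by simp
  then obtain \<sigma> :: real where \<sigma>: "\<sigma> \<noteq> 0" "\<And>j. j \<in> {1..P} \<Longrightarrow> \<sigma> * y j \<ge> 0"
    using toeplitz_constant_imp_one_signed[OF s \<theta>] zero by metis
  have "(\<Sum>j=1..P. flux_kernel s \<theta> (int k - int j) * (\<sigma> * y j)) = \<sigma> * toeplitz s \<theta> P y k"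
    by (simp add: toeplitz_def sum_distrib_left mult_ac)
  also have "\<dots> = 0" using zero[OF k] by simp
  finally have "flux_kernel s \<theta> (int k - int k) * (\<sigma> * y k) = 0"
    using \<sigma>(2) k flux_kernel_nonneg[OF s(1) \<theta>]
    by (subst (asm) sum_nonneg_eq_0_iff) (blast, simp, blast)
  then show ?thesis using \<sigma>(1) by (simp add: flux_kernel_0)
qed

lemma toeplitz_surjective:
  assumes "0 < s" "s < 1" "0 \<le> \<theta>" "\<theta> \<le> 1"
  obtains y where "\<And>n. n \<in> {1..P} \<Longrightarrow> toeplitz s \<theta> P y n = r n"
  using square_system_solvable[of P "\<lambda>n j. flux_kernel s \<theta> (int n - int j)" r]
    toeplitz_injective[OF assms, of P]
  unfolding toeplitz_def by blast

lemma toeplitz_adjoint: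
  "(\<Sum>n=1..P. x n * toeplitz s \<theta> P y n) = (\<Sum>n=1..P. toeplitz s (1 - \<theta>) P x n * y n)"
proof -
  have "(\<Sum>n=1..P. x n * toeplitz s \<theta> P y n)
      = (\<Sum>n=1..P. \<Sum>j=1..P. x n * flux_kernel s \<theta> (int n - int j) * y j)"
    by (simp add: toeplitz_def sum_distrib_left mult_ac)
  also have "\<dots> = (\<Sum>j=1..P. \<Sum>n=1..P. x n * flux_kernel s \<theta> (int n - int j) * y j)"
    by (rule sum.swap)
  also have "\<dots> = (\<Sum>j=1..P. toeplitz s (1 - \<theta>) P x j * y j)"
    
    by (simp add: toeplitz_def sum_distrib_left flux_kernel_minus[symmetric] mult_ac)
  finally show ?thesis .
qed

text \<open>The functional \<open>z\<close> solves the transposed system with right-hand side \<open>1\<close>, so it recovers the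
  total increment of \<open>d\<close> from its flux. Being one-signed and nonzero, it does not vanish
  on positive vectors.\<close>

lemma equilibrium_functional:
  assumes s: "0 < s" "s < 1" and \<theta>: "0 \<le> \<theta>" "\<theta> \<le> 1" and P: "P \<ge> 1"
  obtains z where
    "\<And>d. (\<Sum>n=1..P. z n * toeplitz s \<theta> P d n) = (\<Sum>n=1..P. d n)"
    "\<And>g. (\<And>n. n \<in> {1..P} \<Longrightarrow> g n > 0) \<Longrightarrow> (\<Sum>n=1..P. z n * g n) \<noteq> 0"
proof -
  have \<theta>': "0 \<le> 1 - \<theta>" "1 - \<theta> \<le> 1" using \<theta> by auto
  obtain z where z: "\<And>n. n \<in> {1..P} \<Longrightarrow> toeplitz s (1 - \<theta>) P z n = 1"
    using toeplitz_surjective[OF s \<theta>', of P "\<lambda>_. 1"] by blast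
  obtain \<sigma> :: real where \<sigma>: "\<sigma> \<noteq> 0" "\<And>j. j \<in> {1..P} \<Longrightarrow> \<sigma> * z j \<ge> 0"
    using toeplitz_constant_imp_one_signed[OF s \<theta>' P z] by metis
  show ?thesis
  proof (rule that[of z])
    show "(\<Sum>n=1..P. z n * toeplitz s \<theta> P d n) = (\<Sum>n=1..P. d n)" for d
      unfolding toeplitz_adjoint by (intro sum.cong) (simp_all add: z)
    fix g :: "nat \<Rightarrow> real" assume g: "\<And>n. n \<in> {1..P} \<Longrightarrow> g n > 0"
    show "(\<Sum>n=1..P. z n * g n) \<noteq> 0"
    proof
      assume "(\<Sum>n=1..P. z n * g n) = 0"
      then have "(\<Sum>n=1..P. \<sigma> * z n * g n) = 0"
        by (simp add: sum_distrib_left[symmetric] mult.assoc)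
      then have "\<sigma> * z n * g n = 0" if "n \<in> {1..P}" for n
        using that \<sigma>(2) g by (subst (asm) sum_nonneg_eq_0_iff) (auto simp: less_imp_le)
      then have "z n = 0" if "n \<in> {1..P}" for n
        using that \<sigma>(1) g[of n] by fastforce
      then have "toeplitz s (1 - \<theta>) P z 1 = 0" by (simp add: toeplitz_def)
      with z[of 1] P show False by simp
    qed
  qed
qed

section \<open>Exact evaluation of the fractional integrals\<close>

lemma node_diff: "node a b P n - node a b P j = (real n - real j) * mesh_size a b P"
  by (simp add: node_def left_diff_distrib)

lemma node_mono:
  assumes "a < b" "i \<le> j"
  shows "node a b P i \<le> node a b P j"
  using assms by (simp add: node_def mesh_size_def mult_right_mono divide_right_mono)

lemma node_0 [simp]: "node a b P 0 = a"
  by (simp add: node_def)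

lemma node_P: "P > 0 \<Longrightarrow> node a b P P = b"
  by (simp add: node_def mesh_size_def)

lemma omega_has_integral_left:
  assumes s: "s > 0" and "c \<le> d" "d \<le> x"
  shows "((\<lambda>z. omega s (x - z)) has_integral
           ((x - c) powr s - (x - d) powr s) / (s * Gamma s)) {c..d}"
proof -
  define K where "K = s * Gamma s"
  have K: "K > 0" "omega s t = s * t powr (s - 1) / K" for t
    using s Gamma_real_pos[OF s] by (simp_all add: K_def omega_def)
  define F where "F z = - ((x - z) powr s / K)" for z
  have "((\<lambda>z. omega s (x - z)) has_integral (F d - F c)) {c..d}"
  proof (rule fundamental_theorem_of_calculus_interior)
    show "continuous_on {c..d} F"
      unfolding F_def using assms K(1)
      by (intro continuous_intros continuous_on_powr') auto
    show "(F has_vector_derivative omega s (x - z)) (at z)" if "z \<in> {c<..<d}" for z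
      unfolding F_def has_real_derivative_iff_has_vector_derivative[symmetric] K(2)
      using that assms K(1)
      by (auto intro!: derivative_eq_intros)
  qed fact
  then show ?thesis by (simp add: F_def K_def diff_divide_distrib)
qed

lemma omega_has_integral_right:
  assumes s: "s > 0" and "x \<le> c" "c \<le> d"
  shows "((\<lambda>z. omega s (z - x)) has_integral
           ((d - x) powr s - (c - x) powr s) / (s * Gamma s)) {c..d}"
proof -
  define K where "K = s * Gamma s"
  have K: "K > 0" "omega s t = s * t powr (s - 1) / K" for t
    using s Gamma_real_pos[OF s] by (simp_all add: K_def omega_def)
  define F where "F z = (z - x) powr s / K" for z
  have "((\<lambda>z. omega s (z - x)) has_integral (F d - F c)) {c..d}"
  proof (rule fundamental_theorem_of_calculus_interior)
    show "continuous_on {c..d} F"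
      unfolding F_def using assms K(1)
      by (intro continuous_intros continuous_on_powr') auto
    show "(F has_vector_derivative omega s (z - x)) (at z)" if "z \<in> {c<..<d}" for z
      unfolding F_def has_real_derivative_iff_has_vector_derivative[symmetric] K(2)
      using that assms K(1)
      by (auto intro!: derivative_eq_intros)
  qed fact
  then show ?thesis by (simp add: F_def K_def diff_divide_distrib)
qed

text \<open>With \<open>s = 1 - \<alpha>\<close> this is $\omega_{2-\alpha}(h)$, because
  \<open>s * Gamma s = Gamma (s + 1)\<close>.\<close>

definition mesh_factor :: "real \<Rightarrow> real \<Rightarrow> real" where
  "mesh_factor s h = h powr s / (s * Gamma s)"

lemma powr_scaled_diff:
  assumes "h > 0" "0 \<le> k"
  shows "(((of_int k + 1) * h) powr s - (of_int k * h) powr s) / (s * Gamma s)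
    = mesh_factor s h * weight s k"
proof -
  have "((of_int k + 1) * h) powr s = (of_int k + 1) powr s * h powr s"
    "(of_int k * h) powr s = of_int k powr s * h powr s"
    using assms by (simp_all add: powr_mult)
  then show ?thesis
    using assms by (simp add: mesh_factor_def weight_def left_diff_distrib right_diff_distrib
        diff_divide_distrib mult.commute)
qed

lemma has_integral_indicator_open:
  fixes f :: "real \<Rightarrow> real"
  assumes "(f has_integral I) {c..d}" "{c<..<d} \<subseteq> T"
  shows "((\<lambda>z. f z * (D * indicator {c<..<d} z)) has_integral (I * D)) T"
proof -
  have "(f has_integral I) {c<..<d}"
    using assms(1) has_integral_open_interval[of f I c d] by simp
  then have "((\<lambda>z. if z \<in> {c<..<d} then f z else 0) has_integral I) T"
    using assms(2) by (simp only: has_integral_restrict)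
  from has_integral_mult_left[OF this, of D]
  show ?thesis by (rule has_integral_eq[rotated]) (auto simp: indicator_def)
qed

lemma RL_left_backward_diff:
  assumes ab: "a < b" and s: "s > 0" and n: "n \<in> {1..P}"
  shows "RL_left s a (backward_diff a b P U) (node a b P n)
    = mesh_factor s (mesh_size a b P) * (\<Sum>j=1..P. weight s (int n - int j) * (U j - U (j - 1)))"
proof -
  define h where "h = mesh_size a b P"
  have h: "h > 0" using ab n by (simp add: h_def mesh_size_def)
  let ?x = "node a b P"
  have cell: "((\<lambda>z. omega s (?x n - z) * ((U j - U (j - 1)) * indicator {?x (j - 1)<..<?x j} z))
      has_integral (mesh_factor s h * weight s (int n - int j) * (U j - U (j - 1)))) {a..?x n}"
    if j: "j \<in> {1..P}" for j
  proof (cases "j \<le> n")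
    case True
    have le: "a \<le> ?x (j - 1)" "?x (j - 1) \<le> ?x j" "?x j \<le> ?x n"
      using node_mono[OF ab, of 0 "j - 1" P] node_mono[OF ab, of "j - 1" j P]
        node_mono[OF ab True, of P] by simp_all
    have "((\<lambda>z. omega s (?x n - z)) has_integral mesh_factor s h * weight s (int n - int j))
        {?x (j - 1)..?x j}"
      using omega_has_integral_left[OF s le(2,3)] powr_scaled_diff[OF h, of "int n - int j" s] True j
      by (simp add: node_diff h_def of_nat_diff algebra_simps)
    then show ?thesis
      using le by (intro has_integral_indicator_open) auto
  next
    case False
    have "?x n \<le> ?x (j - 1)" using False by (intro node_mono[OF ab]) auto
    then show ?thesis
      using False by (intro has_integral_is_0[THEN has_integral_eq_rhs])
        (auto simp: weight_def indicator_def)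
  qed
  have "((\<lambda>z. omega s (?x n - z) * backward_diff a b P U z) has_integral
      (\<Sum>j=1..P. mesh_factor s h * weight s (int n - int j) * (U j - U (j - 1)))) {a..?x n}"
    unfolding backward_diff_def sum_distrib_left by (intro has_integral_sum cell) auto
  then show ?thesis
    unfolding RL_left_def h_def
    by (simp add: integral_unique sum_distrib_left mult.assoc)
qed

lemma RL_right_backward_diff:
  assumes ab: "a < b" and s: "s > 0" and n: "n \<in> {1..P}"
  shows "RL_right s b (backward_diff a b P U) (node a b P (n - 1))
    = mesh_factor s (mesh_size a b P) * (\<Sum>j=1..P. weight s (int j - int n) * (U j - U (j - 1)))"
proof -
  define h where "h = mesh_size a b P"
  have h: "h > 0" using ab n by (simp add: h_def mesh_size_def)
  let ?x = "node a b P"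
  have cell: "((\<lambda>z. omega s (z - ?x (n - 1)) * ((U j - U (j - 1)) * indicator {?x (j - 1)<..<?x j} z))
      has_integral (mesh_factor s h * weight s (int j - int n) * (U j - U (j - 1)))) {?x (n - 1)..b}"
    if j: "j \<in> {1..P}" for j
  proof (cases "n \<le> j")
    case True
    have le: "?x (n - 1) \<le> ?x (j - 1)" "?x (j - 1) \<le> ?x j" "?x j \<le> b"
      using True j node_mono[OF ab, of "n - 1" "j - 1" P] node_mono[OF ab, of "j - 1" j P]
        node_mono[OF ab, of j P P] node_P[of P a b] by auto
    have "((\<lambda>z. omega s (z - ?x (n - 1))) has_integral mesh_factor s h * weight s (int j - int n))
        {?x (j - 1)..?x j}"
      using omega_has_integral_right[OF s le(1,2)] powr_scaled_diff[OF h, of "int j - int n" s]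
        True j n
      by (simp add: node_diff h_def of_nat_diff algebra_simps)
    then show ?thesis
      using le by (intro has_integral_indicator_open) auto
  next
    case False
    have "?x j \<le> ?x (n - 1)" using False by (intro node_mono[OF ab]) auto
    then show ?thesis
      using False by (intro has_integral_is_0[THEN has_integral_eq_rhs])
        (auto simp: weight_def indicator_def)
  qed
  have "((\<lambda>z. omega s (z - ?x (n - 1)) * backward_diff a b P U z) has_integral
      (\<Sum>j=1..P. mesh_factor s h * weight s (int j - int n) * (U j - U (j - 1)))) {?x (n - 1)..b}"
    unfolding backward_diff_def sum_distrib_left by (intro has_integral_sum cell) auto
  then show ?thesis
    unfolding RL_right_def h_def
    by (simp add: integral_unique sum_distrib_left mult.assoc)
qed

lemma frac_bracket_eq_toeplitz:
  assumes "a < b" and \<alpha>: "\<alpha> < 1" and n: "n \<in> {1..P}"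
  shows "frac_bracket a b P \<alpha> \<theta> U n =
    mesh_factor (1 - \<alpha>) (mesh_size a b P) * toeplitz (1 - \<alpha>) \<theta> P (\<lambda>j. U j - U (j - 1)) n"
proof -
  have "1 - \<alpha> > 0" using \<alpha> by simp
  note RL = RL_left_backward_diff[OF \<open>a < b\<close> this n] RL_right_backward_diff[OF \<open>a < b\<close> this n]
  show ?thesis
    unfolding frac_bracket_def toeplitz_def flux_kernel_def RL
    by (simp add: distrib_right sum.distrib sum_distrib_left distrib_left mult_ac)
qed

section \<open>The scheme\<close>

lemma telescoped_equations:
  fixes q r :: "nat \<Rightarrow> real"
  assumes "P \<ge> 1"
  shows "(\<forall>n\<in>{1..P-1}. q n - q (n + 1) = r n) \<longleftrightarrow>
         (\<exists>C. \<forall>n\<in>{1..P}. q n = C - (\<Sum>i=1..<n. r i))"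
proof
  assume eqs: "\<forall>n\<in>{1..P-1}. q n - q (n + 1) = r n"
  have "q n = q 1 - (\<Sum>i=1..<n. r i)" if "1 \<le> n" "n \<le> P" for n
    using that
  proof (induction n rule: dec_induct)
    case (step n)
    then have "n \<in> {1..P-1}" by auto
    then have "q n - q (n + 1) = r n" using eqs by blast
    moreover have "q n = q 1 - (\<Sum>i=1..<n. r i)" using step by simp
    moreover have "(\<Sum>i=1..<Suc n. r i) = (\<Sum>i=1..<n. r i) + r n" using step by simp
    ultimately show ?case unfolding Suc_eq_plus1 by linarith
  qed simp
  then show "\<exists>C. \<forall>n\<in>{1..P}. q n = C - (\<Sum>i=1..<n. r i)"
    by (meson atLeastAtMost_iff)
next
  assume "\<exists>C. \<forall>n\<in>{1..P}. q n = C - (\<Sum>i=1..<n. r i)"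
  then obtain C where C: "\<And>n. n \<in> {1..P} \<Longrightarrow> q n = C - (\<Sum>i=1..<n. r i)" by blast
  show "\<forall>n\<in>{1..P-1}. q n - q (n + 1) = r n"
  proof
    fix n assume n: "n \<in> {1..P-1}"
    then have "n \<in> {1..P}" "n + 1 \<in> {1..P}" by auto
    from C[OF this(1)] C[OF this(2)] n show "q n - q (n + 1) = r n" by simp
  qed
qed

lemma midnode_in_domain:
  assumes "a < b" "n < P"
  shows "midnode a b P n \<in> {a<..<b}"
proof -
  have mid: "(l + r) / 2 \<in> {a<..<b}" if "l < r" "a \<le> l" "r \<le> b" for l r :: real
    using that by simp
  have "node a b P (n + 1) - node a b P n = (b - a) / real P"
    by (simp add: node_diff mesh_size_def)
  moreover have "(b - a) / real P > 0" using assms by simp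
  ultimately have "node a b P n < node a b P (n + 1)" by linarith
  moreover have "a \<le> node a b P n" "node a b P (n + 1) \<le> b"
    using assms node_mono[OF assms(1), of 0 n P] node_mono[OF assms(1), of "n + 1" P P]
      node_P[of P a b] by auto
  ultimately show ?thesis unfolding midnode_def by (rule mid)
qed

theorem mainTheorem5:
  fixes a b \<alpha> \<theta> c0 c1 :: real and P :: nat and \<kappa> f :: "real \<Rightarrow> real"
  assumes "a < b" and "P \<ge> 2"
    and "0 < \<alpha>" and "\<alpha> < 1" and "0 \<le> \<theta>" and "\<theta> \<le> 1"
    and "0 < c0" and "0 < c1"
    and "\<And>x. x \<in> {a<..<b} \<Longrightarrow> c0 \<le> \<kappa> x \<and> \<kappa> x \<le> c1"
  shows "\<exists>!U. U \<in> extensional {0..P} \<and> fd_solution a b P \<alpha> \<theta> \<kappa> f U"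
proof -
  have P: "P \<ge> 1" using assms by simp
  define s where "s = 1 - \<alpha>"
  have s: "0 < s" "s < 1" using assms by (auto simp: s_def)
  note \<theta> = \<open>0 \<le> \<theta>\<close> \<open>\<theta> \<le> 1\<close>
  define h where "h = mesh_size a b P"
  define g where "g n = 1 / (mesh_factor s h * \<kappa> (midnode a b P (n - 1)))" for n
  define F where "F n = (\<Sum>i=1..<n. h\<^sup>2 * f (node a b P i))" for n
  have "h > 0" using assms by (simp add: h_def mesh_size_def)
  then have "mesh_factor s h > 0"
    using s Gamma_real_pos[of s] by (simp add: mesh_factor_def)
  moreover have "\<kappa> (midnode a b P (n - 1)) > 0" if "n \<in> {1..P}" for n
    using assms(7) assms(9)[OF midnode_in_domain[OF \<open>a < b\<close>, of "n - 1" P]] that by fastforce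
  ultimately have g: "g n > 0" if "n \<in> {1..P}" for n
    using that by (simp add: g_def)

  \<comment> \<open>Summing the scheme over the nodes turns it into a Toeplitz system with one free constant \<open>C\<close>.\<close>
  have scheme: "fd_solution a b P \<alpha> \<theta> \<kappa> f U \<longleftrightarrow> U 0 = 0 \<and> U P = 0 \<and>
      (\<exists>C. \<forall>n\<in>{1..P}. toeplitz s \<theta> P (\<lambda>j. U j - U (j - 1)) n = g n * (C - F n))" for U
  proof -
    define q where "q n = toeplitz s \<theta> P (\<lambda>j. U j - U (j - 1)) n / g n" for n
    have q: "\<kappa> (midnode a b P (n - 1)) * frac_bracket a b P \<alpha> \<theta> U n = q n" if "n \<in> {1..P}" for n
      using frac_bracket_eq_toeplitz[OF \<open>a < b\<close> \<open>\<alpha> < 1\<close> that, of \<theta> U]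
      by (simp add: q_def g_def s_def h_def)
    have telescope: "(\<forall>n\<in>{1..P-1}. q n - q (n + 1) = h\<^sup>2 * f (node a b P n)) \<longleftrightarrow>
        (\<exists>C. \<forall>n\<in>{1..P}. q n = C - F n)"
      unfolding F_def by (rule telescoped_equations[OF P])
    have "fd_solution a b P \<alpha> \<theta> \<kappa> f U \<longleftrightarrow> U 0 = 0 \<and> U P = 0 \<and>
        (\<forall>n\<in>{1..P-1}. q n - q (n + 1) = h\<^sup>2 * f (node a b P n))"
    proof -
      have "\<kappa> (midnode a b P (n - 1)) * frac_bracket a b P \<alpha> \<theta> U n
          - \<kappa> (midnode a b P n) * frac_bracket a b P \<alpha> \<theta> U (n + 1) = q n - q (n + 1)"
        if "n \<in> {1..P-1}" for n
        using q[of n] q[of "n + 1"] that by force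
      then show ?thesis unfolding fd_solution_def h_def by simp
    qed
    also have "\<dots> \<longleftrightarrow> U 0 = 0 \<and> U P = 0 \<and> (\<exists>C. \<forall>n\<in>{1..P}. q n = C - F n)"
      by (simp only: telescope)
    also have "\<dots> \<longleftrightarrow> U 0 = 0 \<and> U P = 0 \<and>
      (\<exists>C. \<forall>n\<in>{1..P}. toeplitz s \<theta> P (\<lambda>j. U j - U (j - 1)) n = g n * (C - F n))"
    proof -
      have "q n = C - F n \<longleftrightarrow>
          toeplitz s \<theta> P (\<lambda>j. U j - U (j - 1)) n = g n * (C - F n)" if "n \<in> {1..P}" for n C
        using g[OF that] by (auto simp: q_def field_simps)
      then show ?thesis by simp
    qed
    finally show ?thesis .
  qed

  obtain z where z: "\<And>d. (\<Sum>n=1..P. z n * toeplitz s \<theta> P d n) = (\<Sum>n=1..P. d n)"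
    and zg: "(\<Sum>n=1..P. z n * g n) \<noteq> 0"
  proof (rule equilibrium_functional[OF s \<theta> P])
    fix z
    assume z: "\<And>d. (\<Sum>n=1..P. z n * toeplitz s \<theta> P d n) = (\<Sum>n=1..P. d n)"
      and pos: "\<And>g. (\<And>n. n \<in> {1..P} \<Longrightarrow> g n > 0) \<Longrightarrow> (\<Sum>n=1..P. z n * g n) \<noteq> 0"
    show thesis by (rule that[OF z pos[OF g]])
  qed
  have flux: "(\<Sum>n=1..P. z n * (g n * (C - F n))) =
      C * (\<Sum>n=1..P. z n * g n) - (\<Sum>n=1..P. z n * g n * F n)" for C
  proof -
    have "z n * (g n * (C - F n)) = C * (z n * g n) - z n * g n * F n" for n
      by (simp add: algebra_simps)
    then show ?thesis by (simp only: sum_subtractf sum_distrib_left)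
  qed
  \<comment> \<open>\<open>C0\<close> is the only constant for which the increments add up to zero, that is, for which
    \<open>U P = 0\<close> is compatible with \<open>U 0 = 0\<close>.\<close>
  define C0 where "C0 = (\<Sum>n=1..P. z n * g n * F n) / (\<Sum>n=1..P. z n * g n)"
  have closure: "(\<Sum>n=1..P. d n) = 0 \<longleftrightarrow> C = C0"
    if "\<And>n. n \<in> {1..P} \<Longrightarrow> toeplitz s \<theta> P d n = g n * (C - F n)" for d C
  proof -
    have "(\<Sum>n=1..P. d n) = (\<Sum>n=1..P. z n * toeplitz s \<theta> P d n)" by (rule z[symmetric])
    also have "\<dots> = (\<Sum>n=1..P. z n * (g n * (C - F n)))"
      by (intro sum.cong) (simp_all only: that)
    finally show ?thesis unfolding flux C0_def using zg by (simp add: eq_divide_eq)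
  qed

  obtain d where d: "\<And>n. n \<in> {1..P} \<Longrightarrow> toeplitz s \<theta> P d n = g n * (C0 - F n)"
    using toeplitz_surjective[OF s \<theta>, of P "\<lambda>n. g n * (C0 - F n)"] by blast
  have sol_iff: "fd_solution a b P \<alpha> \<theta> \<kappa> f U \<longleftrightarrow> (\<forall>n\<in>{0..P}. U n = (\<Sum>j=1..n. d j))" for U
  proof
    assume "fd_solution a b P \<alpha> \<theta> \<kappa> f U"
    then obtain C where U: "U 0 = 0" "U P = 0"
      and C: "\<And>n. n \<in> {1..P} \<Longrightarrow> toeplitz s \<theta> P (\<lambda>j. U j - U (j - 1)) n = g n * (C - F n)"
      unfolding scheme by blast
    have part: "(\<Sum>j=1..n. U j - U (j - 1)) = U n" for n
      using U(1) by (induction n) auto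
    have "C = C0" using closure[OF C] part[of P] U(2) by simp
    have "toeplitz s \<theta> P (\<lambda>j. (U j - U (j - 1)) - d j) n = 0" if "n \<in> {1..P}" for n
      using C[OF that] d[OF that] \<open>C = C0\<close>
      by (simp add: toeplitz_def right_diff_distrib sum_subtractf)
    then have "U j - U (j - 1) = d j" if "j \<in> {1..P}" for j
      using toeplitz_injective[OF s \<theta>, of P "\<lambda>j. (U j - U (j - 1)) - d j" j] that by simp
    then have "(\<Sum>j=1..n. d j) = (\<Sum>j=1..n. U j - U (j - 1))" if "n \<le> P" for n
      using that by (intro sum.cong) auto
    then show "\<forall>n\<in>{0..P}. U n = (\<Sum>j=1..n. d j)" using part by simp
  next
    assume U: "\<forall>n\<in>{0..P}. U n = (\<Sum>j=1..n. d j)"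
    have "U j - U (j - 1) = d j" if "j \<in> {1..P}" for j
      using U that by (cases j) simp_all
    then have "toeplitz s \<theta> P (\<lambda>j. U j - U (j - 1)) n = toeplitz s \<theta> P d n" for n
      by (simp add: toeplitz_def)
    moreover have "U P = 0" using U closure[OF d] by simp
    ultimately show "fd_solution a b P \<alpha> \<theta> \<kappa> f U"
      unfolding scheme using U d by auto
  qed
  show ?thesis
  proof (rule ex1I[of _ "restrict (\<lambda>n. \<Sum>j=1..n. d j) {0..P}"])
    fix U assume "U \<in> extensional {0..P} \<and> fd_solution a b P \<alpha> \<theta> \<kappa> f U"
    then show "U = restrict (\<lambda>n. \<Sum>j=1..n. d j) {0..P}"
      unfolding sol_iff by (intro extensionalityI[of _ "{0..P}"]) auto
  qed (simp add: sol_iff)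
qed

end
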